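(* Let $X$ and $Y$ be two real random variables with finite means and distribution functions $F$ and $G$, respectively. If $S^-(G^{-1}-F^{-1})$ is finite and nonzero, and the last sign change of $G^{-1}-F^{-1}$ on $(0,1)$ occurs from $-$ to $+$, then $X\leq_{p_n\text{-tvar}}Y$, where $p_n$ denotes the last crossing point.
   Context: For a random variable $X$ with distribution function $F$, the quantile function is $F^{-1}(p)=\inf\{x: F(x)\geq p\}$ for $p\in(0,1)$, and the tail value at risk is $\mathrm{TVaR}_p(X)=\frac{1}{1-p}\int_p^1 F^{-1}(u)\,du$ for $p\in[0,1)$. For $p_0\in[0,1)$, $X\leq_{p_0\text{-tvar}}Y$ means that $\mathrm{TVaR}_p(X)\leq\mathrm{TVaR}_p(Y)$ for all $p\in(p_0,1)$. For a function $h$, $S^-(h)$ denotes the number of sign changes of $h$ on its domain (here $(0,1)$), where zero terms are discarded; that is, the supremum over finite increasing sequences $u_1<\dots<u_m$ of points of the domain of the number of sign changes in the sequence $h(u_1),\dots,h(u_m)$ after deleting zeros. If $S^-(h)$ is finite and nonzero, the last sign change occurs from $-$ to $+$ when the last sign taken by $h$ is $+$, i.e. there is a point with $h>0$ to the right of all points where $h<0$. The last crossing point is then $p_n=\sup\{p\in(0,1): h(p)<0\}$ with $h=G^{-1}-F^{-1}$, so that $h\geq 0$ on $(p_n,1)$. *)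

theory Defs
  imports "HOL-Probability.Probability" "HOL-Library.Extended_Nat"
begin

definition dist_fun :: "'a measure \<Rightarrow> ('a \<Rightarrow> real) \<Rightarrow> real \<Rightarrow> real" where
  "dist_fun M X = cdf (distr M borel X)"

text \<open>Only meaningful for \<open>p \<in> (0,1)\<close>, where the set is nonempty and bounded below
  if \<open>F\<close> is a distribution function.\<close>

definition quantile :: "(real \<Rightarrow> real) \<Rightarrow> real \<Rightarrow> real" where
  "quantile F p = Inf {x. F x \<ge> p}"

text \<open>The integral is taken over the open interval, so that the quantile function is only
  used on \<open>(0,1)\<close>.\<close>

definition TVaR :: "'a measure \<Rightarrow> ('a \<Rightarrow> real) \<Rightarrow> real \<Rightarrow> real" where
  "TVaR M X p = 1 / (1 - p) * (LBINT u:{p<..<1}. quantile (dist_fun M X) u)"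

text \<open>The level is required to lie in \<open>[0,1)\<close>; otherwise the relation would hold vacuously
  for levels \<open>p0 \<ge> 1\<close>. The two random variables may live on different probability spaces.\<close>

definition tvar_le ::
  "real \<Rightarrow> 'a measure \<Rightarrow> ('a \<Rightarrow> real) \<Rightarrow> 'b measure \<Rightarrow> ('b \<Rightarrow> real) \<Rightarrow> bool" where
  "tvar_le p0 M X N Y \<longleftrightarrow>
     p0 \<in> {0..<1} \<and> (\<forall>p\<in>{p0<..<1}. TVaR M X p \<le> TVaR N Y p)"

definition seq_sign_changes :: "real list \<Rightarrow> nat" where
  "seq_sign_changes xs =
     (let ys = filter (\<lambda>x. x \<noteq> 0) xs
      in card {i. Suc i < length ys \<and> sgn (ys ! i) \<noteq> sgn (ys ! Suc i)})"

definition sign_changes :: "real set \<Rightarrow> (real \<Rightarrow> real) \<Rightarrow> enat" where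
  "sign_changes D h =
     (SUP us \<in> {us. sorted_wrt (<) us \<and> set us \<subseteq> D}. enat (seq_sign_changes (map h us)))"

text \<open>To be used when the number of sign changes is finite and nonzero: the last sign taken
  by \<open>h\<close> on \<open>D\<close> is \<open>+\<close>.\<close>

definition last_change_neg_to_pos :: "real set \<Rightarrow> (real \<Rightarrow> real) \<Rightarrow> bool" where
  "last_change_neg_to_pos D h \<longleftrightarrow>
     (\<exists>u\<in>D. h u > 0 \<and> (\<forall>v\<in>D. h v < 0 \<longrightarrow> v < u))"

text \<open>The last crossing point when the last sign change is from \<open>-\<close> to \<open>+\<close>.\<close>

definition last_crossing :: "real set \<Rightarrow> (real \<Rightarrow> real) \<Rightarrow> real" where
  "last_crossing D h = Sup {p \<in> D. h p < 0}"

end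

theory Submission
  imports Defs
begin

text \<open>
  To the right of the last crossing point \<open>p\<^sub>n\<close> one has \<open>F\<inverse> \<le> G\<inverse>\<close> pointwise. Integrating this
  inequality over \<open>(p, 1)\<close> and dividing by \<open>1 - p > 0\<close> yields the comparison of the tail values at
  risk at every level \<open>p > p\<^sub>n\<close>.

  Two points need an argument. First, monotonicity of the integral requires both quantile functions
  to be integrable near \<open>1\<close>. This is where the finite means enter: under the uniform distribution on
  \<open>(0,1)\<close>, the quantile function of \<open>X\<close> has the same law as \<open>X\<close>
  (lemma \<open>set_integrable_quantile\<close>). Second, \<open>p\<^sub>n\<close> must be a level in \<open>[0,1)\<close>. It is
  the supremum of the set where \<open>G\<inverse> - F\<inverse>\<close> is negative; this set is nonempty because a function
  without negative values has no sign change (lemma \<open>sign_changes_nonneg\<close>), and it is bounded by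
  a point of \<open>(0,1)\<close> because the last sign is \<open>+\<close>
  (lemma \<open>last_crossing_mem_unit_interval\<close>).
\<close>

text \<open>
  Quantile transform: if \<open>U\<close> is uniform on \<open>(0,1)\<close>, then \<open>F\<inverse>(U)\<close> is distributed as \<open>X\<close>, so the
  integral of \<open>\<bar>F\<inverse>\<bar>\<close> over \<open>(0,1)\<close> is the first absolute moment of \<open>X\<close>.
\<close>

lemma (in prob_space) set_integrable_quantile:
  assumes X: "integrable M X"
  shows "set_integrable lborel {0<..<1} (quantile (dist_fun M X))"
proof -
  have [measurable]: "X \<in> borel_measurable M"
    using X by auto
  define D where "D = distr M borel X"
  let ?U = "restrict_space lborel {0<..<1::real}"
  let ?Q = "quantile (dist_fun M X)"
  interpret D: cdf_distribution D
    unfolding cdf_distribution_def D_def by (rule real_distribution_distr) simp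
  have Q: "?Q = (\<lambda>u. Inf {x. u \<le> cdf D x})"
    by (simp add: quantile_def[abs_def] dist_fun_def D_def)
  have Q_meas: "?Q \<in> borel_measurable ?U"
    unfolding Q using D.measurable_CI
    by (simp cong: measurable_cong_sets add: sets_restrict_space)
  have "integrable D (\<lambda>x. x)"
    unfolding D_def using X by (subst integrable_distr_eq) auto
  moreover have "distr ?U borel ?Q = D"
    unfolding Q by (rule D.distr_I_eq_M)
  ultimately have "integrable (distr ?U borel ?Q) (\<lambda>x. x)"
    by simp
  then have "integrable ?U ?Q"
    using integrable_distr[OF Q_meas] by blast
  then show ?thesis
    by (simp add: set_integrable_def integrable_restrict_space)
qed

lemma sign_changes_nonneg:
  assumes "\<And>x. x \<in> D \<Longrightarrow> h x \<ge> 0"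
  shows "sign_changes D h = 0"
proof -
  have "seq_sign_changes (map h us) = 0" if "set us \<subseteq> D" for us
  proof -
    define ys where "ys = filter (\<lambda>x. x \<noteq> 0) (map h us)"
    have "y > 0" if "y \<in> set ys" for y
      using that assms \<open>set us \<subseteq> D\<close> by (force simp: ys_def order.strict_iff_order)
    then have "sgn (ys ! i) = 1" if "i < length ys" for i
      using that by (simp add: sgn_1_pos)
    then have "{i. Suc i < length ys \<and> sgn (ys ! i) \<noteq> sgn (ys ! Suc i)} = {}"
      by auto
    then show ?thesis
      unfolding seq_sign_changes_def Let_def ys_def[symmetric] by (simp only: card.empty)
  qed
  then have "sign_changes D h \<le> 0"
    unfolding sign_changes_def by (intro SUP_least) (auto simp: zero_enat_def)
  then show ?thesis
    by simp
qed

lemma nonneg_right_of_last_crossing: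
  assumes "bdd_above D" and "p \<in> D" and "last_crossing D h < p"
  shows "h p \<ge> 0"
proof (rule ccontr)
  assume "\<not> h p \<ge> 0"
  then have "p \<le> last_crossing D h"
    unfolding last_crossing_def using assms(1,2)
    by (intro cSup_upper bdd_above_mono[OF assms(1)]) auto
  with assms(3) show False
    by simp
qed

text \<open>
  The strict upper bound \<open>1\<close> comes from the positive value of \<open>h\<close> to the right of all negative
  ones: that point is itself smaller than \<open>1\<close>.
\<close>

lemma last_crossing_mem_unit_interval:
  assumes "sign_changes {0<..<1} h \<noteq> 0" and "last_change_neg_to_pos {0<..<1} h"
  shows "last_crossing {0<..<1} h \<in> {0<..<1}"
proof -
  let ?neg = "{p \<in> {0<..<1}. h p < 0}"
  obtain q where q: "q \<in> ?neg"
    using sign_changes_nonneg[of "{0<..<1}" h] assms(1) by force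
  obtain u where u: "u < 1" "\<And>v. v \<in> ?neg \<Longrightarrow> v < u"
    using assms(2) unfolding last_change_neg_to_pos_def by auto
  have "q \<le> Sup ?neg"
    using q u(2) by (intro cSup_upper bdd_aboveI[of _ u]) (auto intro: less_imp_le)
  moreover have "Sup ?neg \<le> u"
    using q u(2) by (intro cSup_least) (auto intro: less_imp_le)
  ultimately show ?thesis
    using q u(1) by (auto simp: last_crossing_def)
qed

theorem theorem2p9:
  fixes M :: "'a measure" and N :: "'b measure"
    and X :: "'a \<Rightarrow> real" and Y :: "'b \<Rightarrow> real"
    and h :: "real \<Rightarrow> real"
  assumes "prob_space M" and "prob_space N"
    and "X \<in> borel_measurable M" and "Y \<in> borel_measurable N"
    and "integrable M X" and "integrable N Y"
    and h: "h = (\<lambda>p. quantile (dist_fun N Y) p - quantile (dist_fun M X) p)"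
    and "sign_changes {0<..<1} h \<noteq> \<infinity>"
    and "sign_changes {0<..<1} h \<noteq> 0"
    and "last_change_neg_to_pos {0<..<1} h"
  shows "tvar_le (last_crossing {0<..<1} h) M X N Y"
  unfolding tvar_le_def
proof (intro conjI ballI)
  let ?pn = "last_crossing {0<..<1} h"
  have pn: "0 < ?pn" "?pn < 1"
    using last_crossing_mem_unit_interval[OF assms(9,10)] by auto
  then show "?pn \<in> {0..<1}"
    by simp
  fix p assume p: "p \<in> {?pn<..<1}"
  have "(LBINT u:{p<..<1}. quantile (dist_fun M X) u)
      \<le> (LBINT u:{p<..<1}. quantile (dist_fun N Y) u)"
  proof (rule set_integral_mono)
    show "set_integrable lborel {p<..<1} (quantile (dist_fun M X))"
      by (rule set_integrable_subset
          [OF prob_space.set_integrable_quantile[OF \<open>prob_space M\<close> \<open>integrable M X\<close>]])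
        (use p pn in auto)
    show "set_integrable lborel {p<..<1} (quantile (dist_fun N Y))"
      by (rule set_integrable_subset
          [OF prob_space.set_integrable_quantile[OF \<open>prob_space N\<close> \<open>integrable N Y\<close>]])
        (use p pn in auto)
    fix u assume "u \<in> {p<..<1}"
    then have "h u \<ge> 0"
      using p pn by (intro nonneg_right_of_last_crossing[of "{0<..<1}"]) auto
    then show "quantile (dist_fun M X) u \<le> quantile (dist_fun N Y) u"
      by (simp add: h)
  qed
  then show "TVaR M X p \<le> TVaR N Y p"
    unfolding TVaR_def using p by (intro mult_left_mono) auto
qed

end
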